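(* Let $m$ and $k$ be positive integers such that $m$ is odd and $k \geq 4$. Let $G$ be a finite simple bipartite graph. If $G$ is $k$-chordal, then the $m$-th bipartite power $G^{[m]}$ is also $k$-chordal.
   Context: A hole in a graph is an induced (chordless) cycle. A graph is $k$-chordal if it has no hole with more than $k$ vertices. For a bipartite graph $G$ and an odd positive integer $m$, the $m$-th bipartite power $G^{[m]}$ is the graph with vertex set $V(G)$ and edge set $\{(u,v) : u,v \in V(G),\ d_G(u,v) \text{ is odd and } d_G(u,v) \leq m\}$, where $d_G$ denotes the distance in $G$. *)

theory Defs
  imports
    "Graph_Theory.Pair_Digraph"
    "Graph_Theory.Digraph_Component"
    "Graph_Theory.Shortest_Path"
begin

text \<open>Finite simple graphs are modelled by the locale predicate \<^const>\<open>pair_graph\<close>: each undirected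
  edge is represented by its two opposite arcs.\<close>

definition bipartite :: "'a pair_pre_digraph \<Rightarrow> bool" where
  "bipartite G \<longleftrightarrow> (\<exists>A B. A \<union> B = pverts G \<and> A \<inter> B = {} \<and> parcs G \<subseteq> (A \<times> B) \<union> (B \<times> A))"

text \<open>With unit arc costs the minimal walk cost is the usual graph distance; it is \<open>\<infinity>\<close>
  between different components.\<close>

definition gdist :: "'a pair_pre_digraph \<Rightarrow> 'a \<Rightarrow> 'a \<Rightarrow> ereal" where
  "gdist G u v = wf_digraph.\<mu> (with_proj G) (\<lambda>_. 1) u v"

definition bipartite_power :: "'a pair_pre_digraph \<Rightarrow> nat \<Rightarrow> 'a pair_pre_digraph" where
  "bipartite_power G m =
     \<lparr> pverts = pverts G,
       parcs = {(u, v). u \<in> pverts G \<and> v \<in> pverts G \<and>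
                  (\<exists>d::nat. gdist G u v = ereal (real d) \<and> odd d \<and> d \<le> m)} \<rparr>"

text \<open>A hole is given by its vertex set \<open>S\<close>: the subgraph induced on \<open>S\<close> is a cycle. The length
  bound is needed because \<^const>\<open>pre_digraph.cycle\<close> also accepts the closed walk
  \<open>a, b, a\<close> in a symmetric digraph. Triangles count as holes here; this does not affect
  \<open>k\<close>-chordality for \<open>k \<ge> 3\<close>.\<close>

definition hole :: "'a pair_pre_digraph \<Rightarrow> 'a set \<Rightarrow> bool" where
  "hole G S \<longleftrightarrow>
     (\<exists>p. pre_digraph.cycle (with_proj G) p \<and> 3 \<le> length p \<and> fst ` set p = S \<and>
          arcs (with_proj G \<restriction> S) = set p \<union> (set p)\<inverse>)"

definition k_chordal :: "nat \<Rightarrow> 'a pair_pre_digraph \<Rightarrow> bool" where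
  "k_chordal k G \<longleftrightarrow> \<not> (\<exists>S. hole G S \<and> k < card S)"

end

theory Submission
  imports Defs
begin

text \<open>Let \<open>v\<^sub>0, \<dots>, v\<^sub>n\<^sub>-\<^sub>1\<close> be a hole of the power with \<open>n > k\<close>; then \<open>n\<close> is even, so
  \<open>n \<ge> 6\<close>, and vertices of opposite parity that are not consecutive are at distance at least
  \<open>m + 2\<close> in \<open>G\<close>. Say that \<open>x\<close> is near the label \<open>J\<close> if \<open>d(v\<^sub>J, x) + d(x, v\<^sub>J\<^sub>+\<^sub>1) \<le> m\<close>. Adjacent
  vertices of \<open>G\<close> have labels at cyclic distance at most 2. Consider closed walks in \<open>G\<close>
  through labelled vertices whose labels grow by 0, 1 or 2 in each step and wind once around the
  hole; geodesics between consecutive \<open>v\<^sub>J\<close> provide one. A chord of such a walk yields a shorter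
  one, so a shortest one is an induced cycle. It has length at least \<open>n\<close>, because the height
  \<open>J + min (d(v\<^sub>J, x)) (d(v\<^sub>J\<^sub>-\<^sub>1, x) - 1)\<close> grows by at most 1 in each step and by \<open>n\<close> altogether.\<close>

section \<open>Cycles with distant vertices\<close>

text \<open>Labels are integers, so that a walk once around the cycle leads from \<open>J\<close> to \<open>J + n\<close>. The
  carrier \<open>C\<close> is a connected component: distances between components would be junk.\<close>

locale spread_cycle =
  fixes E :: "'a rel" and C :: "'a set" and d :: "'a \<Rightarrow> 'a \<Rightarrow> nat"
    and m n :: nat and v :: "int \<Rightarrow> 'a"
  assumes E_sym: "(x, y) \<in> E \<Longrightarrow> (y, x) \<in> E"
    and E_irrefl: "(x, x) \<notin> E"
    and d_refl: "d x x = 0"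
    and d_sym: "\<lbrakk>x \<in> C; y \<in> C\<rbrakk> \<Longrightarrow> d x y = d y x"
    and d_triangle: "\<lbrakk>x \<in> C; y \<in> C; z \<in> C\<rbrakk> \<Longrightarrow> d x z \<le> d x y + d y z"
    and E_closed: "\<lbrakk>x \<in> C; (x, y) \<in> E\<rbrakk> \<Longrightarrow> y \<in> C"
    and E_dist: "\<lbrakk>x \<in> C; (x, y) \<in> E\<rbrakk> \<Longrightarrow> d x y \<le> 1"
    and geodesic: "\<lbrakk>x \<in> C; y \<in> C\<rbrakk> \<Longrightarrow> (x, y) \<in> E ^^ d x y"
    and v_in: "v i \<in> C"
    and v_periodic: "v (i + int n) = v i"
    and v_neq: "v i \<noteq> v (i + 1)"
    and v_near: "d (v i) (v (i + 1)) \<le> m"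
    and v_far: "\<lbrakk>odd (j - i); \<not> int n dvd j - i - 1; \<not> int n dvd j - i + 1\<rbrakk>
                \<Longrightarrow> m + 2 \<le> d (v i) (v j)"
    and n_even: "even n" and n_ge: "6 \<le> n"
begin

section \<open>Labelled vertices, steps between them and the growth of the height\<close>

definition near :: "int \<Rightarrow> 'a \<Rightarrow> bool" where
  "near J x \<longleftrightarrow> x \<in> C \<and> d (v J) x + d x (v (J + 1)) \<le> m"

definition step :: "('a \<times> int) rel" where
  "step = {((x, J), (y, J')). (x, y) \<in> E \<and> near J x \<and> near J' y \<and> J \<le> J' \<and> J' \<le> J + 2}"

text \<open>An index plus the distance from the cycle vertex of that index, minimised over the
  indices \<open>J\<close> and \<open>J - 1\<close>; at \<open>v J\<close> itself this is
  \<open>J\<close>. Using two indices lets a step from label \<open>J\<close> to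
  \<open>J + 1\<close> keep \<open>v J\<close> as a reference vertex.\<close>

definition height :: "int \<Rightarrow> 'a \<Rightarrow> int" where
  "height J x = J + min (int (d (v J) x)) (int (d (v (J - 1)) x) - 1)"

lemma near_shift: "near (J + int n) x \<longleftrightarrow> near J x"
  using v_periodic[of J] v_periodic[of "J + 1"] by (simp add: near_def algebra_simps)

lemma height_shift: "height (J + int n) x = height J x + int n"
  using v_periodic[of J] v_periodic[of "J - 1"] by (simp add: height_def algebra_simps)

lemma d_v_step: "\<lbrakk>x \<in> C; (x, y) \<in> E\<rbrakk> \<Longrightarrow> d (v i) y \<le> d (v i) x + 1"
  using d_triangle[OF v_in, of x y i] E_dist[of x y] E_closed[of x y] by force

lemma d_v_via: "\<lbrakk>x \<in> C; y \<in> C; (x, y) \<in> E\<rbrakk> \<Longrightarrow> d (v i) (v j) \<le> d (v i) x + 1 + d y (v j)"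
  using d_triangle[of "v i" y "v j"] d_v_step[of x y i] v_in by fastforce

lemma not_n_dvd: "\<lbrakk>0 < c; c < 6\<rbrakk> \<Longrightarrow> \<not> int n dvd c"
  using n_ge by (auto dest: zdvd_imp_le)

text \<open>The two numbers that must not be multiples of \<open>n\<close> are 2 and 4, and
  \<open>6 \<le> n\<close> ensures this.\<close>

lemma v_far3: "m + 2 \<le> d (v i) (v (i + 3))"
  using v_far[of "i + 3" i] not_n_dvd[of 2] not_n_dvd[of 4] by simp

text \<open>Any two pairings of the ends of two paths at distance at most 1 have total length
  at most \<open>2 * m + 2\<close>, whereas two far pairs would need \<open>2 * m + 4\<close>.\<close>

lemma near_adjacent:
  assumes x: "near i x" and y: "near j y" and xy: "(x, y) \<in> E"
  obtains e where "- 2 \<le> e" "e \<le> 2" "int n dvd j - i - e"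
proof (rule ccontr)
  assume neg: "\<not> thesis"
  have e: "\<not> int n dvd j - i - e" if "- 2 \<le> e" "e \<le> 2" for e
    using neg that \<open>\<And>e. - 2 \<le> e \<Longrightarrow> e \<le> 2 \<Longrightarrow> int n dvd j - i - e \<Longrightarrow> thesis\<close> by blast
  have C: "x \<in> C" "y \<in> C" using x y by (auto simp: near_def)
  have yx: "(y, x) \<in> E" using E_sym xy .
  have sums: "d (v i) x + d x (v (i + 1)) \<le> m" "d (v j) y + d y (v (j + 1)) \<le> m"
    using x y by (auto simp: near_def)
  have sym: "d (v k) z = d z (v k)" if "z \<in> C" for k z
    using d_sym[OF v_in that] .
  show False
  \<comment> \<open>\<open>v_far\<close> applies to odd index differences only, so the parity of
    \<open>j - i\<close> selects the pairing: equal ends if it is odd, crossed ends if it is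
    even.\<close>
  proof (cases "odd (j - i)")
    case True
    have "m + 2 \<le> d (v i) (v j)"
      using v_far[of j i] e[of 1] e[of "-1"] True by simp
    moreover have "m + 2 \<le> d (v (i + 1)) (v (j + 1))"
      using v_far[of "j + 1" "i + 1"] e[of 1] e[of "-1"] True by simp
    moreover have "d (v i) (v j) \<le> d (v i) x + 1 + d y (v j)"
      "d (v (i + 1)) (v (j + 1)) \<le> d (v (i + 1)) x + 1 + d y (v (j + 1))"
      using d_v_via C xy by blast+
    ultimately show False using sums sym[OF C(1)] sym[OF C(2)] by simp
  next
    case False
    have "m + 2 \<le> d (v i) (v (j + 1))"
      using v_far[of "j + 1" i] e[of 0] e[of "-2"] False by (simp add: algebra_simps)
    moreover have "m + 2 \<le> d (v (i + 1)) (v j)"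
      using v_far[of "j" "i + 1"] e[of 0] e[of "2"] False by (simp add: algebra_simps)
    moreover have "d (v i) (v (j + 1)) \<le> d (v i) x + 1 + d y (v (j + 1))"
      "d (v (i + 1)) (v j) \<le> d (v (i + 1)) x + 1 + d y (v j)"
      using d_v_via C xy by blast+
    ultimately show False using sums sym[OF C(1)] sym[OF C(2)] by simp
  qed
qed

text \<open>If the label grows, a reference vertex that is dropped is replaced by the one two
  indices later. By \<open>v_far3\<close> the new one is closer to \<open>y\<close> by at least 2,
  which pays for the larger index. What remains is the growth of distances along one arc.\<close>

lemma height_step:
  assumes "((x, J), (y, J')) \<in> step"
  shows "height J' y \<le> height J x + 1"
proof -
  have xy: "(x, y) \<in> E" and near: "near J x" "near J' y" and J: "J \<le> J'" "J' \<le> J + 2"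
    using assms by (auto simp: step_def)
  have C: "x \<in> C" "y \<in> C" using near by (auto simp: near_def)
  have sums: "d (v J) x + d x (v (J + 1)) \<le> m" "d (v J') y + d y (v (J' + 1)) \<le> m"
    using near by (auto simp: near_def)
  have sym: "d z (v k) = d (v k) z" if "z \<in> C" for k z
    using d_sym[OF that v_in] .
  have y_le: "d (v k) y \<le> d (v k) x + 1" for k
    using d_v_step C xy by blast
  have to_end: "d (v k) (v (J' + 1)) \<le> d (v k) y + d y (v (J' + 1))" for k
    using d_triangle v_in C by blast
  consider "J' = J" | "J' = J + 1" | "J' = J + 2" using J by linarith
  then show ?thesis
  proof cases
    case 1
    then show ?thesis using y_le[of J] y_le[of "J - 1"] by (simp add: height_def)
  next
    case 2
    have "m + 2 \<le> d (v (J - 1)) (v (J' + 1))"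
      using v_far3[of "J - 1"] 2 by (simp add: algebra_simps)
    then have "d (v J') y + 2 \<le> d (v (J - 1)) y"
      using to_end[of "J - 1"] sums by linarith
    then show ?thesis
      using 2 y_le[of J] y_le[of "J - 1"] by (auto simp: height_def min_def)
  next
    case 3
    have "m + 2 \<le> d (v J) (v (J' + 1))"
      using v_far3[of J] 3 by (simp add: algebra_simps)
    then have t: "d (v J') y + 2 \<le> d (v J) y"
      using to_end[of J] sums by linarith
    \<comment> \<open>The label of \<open>y\<close> gives no bound for its distance from
      \<open>v (J + 1)\<close>. That bound comes from \<open>x\<close>, whose distances from
      \<open>v J\<close> and \<open>v (J + 1)\<close> add up to at most \<open>m\<close>; it is
      compared with the far pair \<open>J - 1\<close>, \<open>J + 2\<close>.\<close>
    have "m + 2 \<le> d (v (J - 1)) (v J')"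
      using v_far3[of "J - 1"] 3 by (simp add: algebra_simps)
    then have "m + 2 \<le> d (v (J - 1)) y + d (v J') y"
      using d_triangle[of "v (J - 1)" y "v J'"] v_in C sym[OF C(2), of J'] by simp
    moreover have "d (v (J + 1)) y \<le> d (v (J + 1)) x + 1" using y_le .
    ultimately have "d (v (J + 1)) y + 2 \<le> d (v (J - 1)) y"
      using t sums y_le[of J] sym[OF C(1), of "J + 1"] by linarith
    then show ?thesis
      using 3 t y_le[of J] y_le[of "J - 1"] by (auto simp: height_def min_def algebra_simps)
  qed
qed

lemma height_steps:
  "((x, J), (y, J')) \<in> step ^^ L \<Longrightarrow> height J' y \<le> height J x + int L"
proof (induction L arbitrary: y J')
  case (Suc L)
  then obtain z K where z: "((x, J), (z, K)) \<in> step ^^ L" "((z, K), (y, J')) \<in> step"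
    by auto
  show ?case using Suc.IH[OF z(1)] height_step[OF z(2)] by simp
qed simp

section \<open>Shortest closed walks winding once around the cycle\<close>

definition closed_length :: "nat \<Rightarrow> bool" where
  "closed_length L \<longleftrightarrow> (\<exists>x J. ((x, J), (x, J + int n)) \<in> step ^^ L)"

lemma closed_length_ge: "closed_length L \<Longrightarrow> n \<le> L"
  unfolding closed_length_def using height_steps height_shift by fastforce

lemma relpow_dist:
  "\<lbrakk>x \<in> C; (x, y) \<in> E ^^ k\<rbrakk> \<Longrightarrow> y \<in> C \<and> d x y \<le> k"
proof (induction k arbitrary: y)
  case (Suc k)
  then obtain z where z: "(x, z) \<in> E ^^ k" "(z, y) \<in> E" by auto
  then have "z \<in> C" "d x z \<le> k" using Suc.IH Suc.prems(1) by auto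
  then show ?case
    using z E_closed E_dist[of z y] d_triangle[of x z y] Suc.prems(1) by fastforce
qed (simp add: d_refl)

lemma near_v: "near J (v J)"
  using v_in v_near by (auto simp: near_def d_refl)

text \<open>A vertex of a geodesic splits its length, which is at most \<open>m\<close>, so all of
  them are near \<open>i\<close>. The label rises on the last arc only, and such an arc exists
  because the ends differ.\<close>

lemma steps_segment: "((v i, i), (v (i + 1), i + 1)) \<in> step\<^sup>*"
proof -
  let ?l = "d (v i) (v (i + 1))"
  obtain g where g: "g 0 = v i" "g ?l = v (i + 1)" "\<And>k. k < ?l \<Longrightarrow> (g k, g (Suc k)) \<in> E"
    using geodesic[OF v_in v_in, of i "i + 1"] by (auto simp: relpow_fun_conv)
  have sub: "(g a, g (a + k)) \<in> E ^^ k" if "a + k \<le> ?l" for a k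
    using g(3) that unfolding relpow_fun_conv
    by (intro exI[of _ "\<lambda>i. g (a + i)"]) auto
  have gC: "g k \<in> C \<and> d (v i) (g k) \<le> k" if "k \<le> ?l" for k
    using relpow_dist[OF v_in, of i "g k" k] sub[of 0 k] g(1) that by simp
  have near: "near i (g k)" if k: "k \<le> ?l" for k
  proof -
    have "d (g k) (v (i + 1)) \<le> ?l - k"
      using relpow_dist[of "g k" "v (i + 1)" "?l - k"] gC[OF k] sub[of k "?l - k"] g(2) k by simp
    then show ?thesis using gC[OF k] v_near[of i] k unfolding near_def by linarith
  qed
  have "k \<le> ?l \<Longrightarrow> ((v i, i), (g k, i)) \<in> step\<^sup>*" for k
  proof (induction k)
    case (Suc k)
    have "((g k, i), (g (Suc k), i)) \<in> step"
      using Suc.prems g(3)[of k] near[of k] near[of "Suc k"] by (simp add: step_def)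
    then show ?case using Suc by (simp add: rtrancl_into_rtrancl)
  qed (simp add: g)
  moreover obtain k where k: "?l = Suc k"
    using v_neq[of i] g(1,2) by (metis not0_implies_Suc)
  moreover have "((g k, i), (v (i + 1), i + 1)) \<in> step"
    using k g(2) g(3)[of k] near[of k] near_v[of "i + 1"] by (simp add: step_def)
  ultimately show ?thesis by (metis le_SucI order_refl rtrancl_into_rtrancl)
qed

lemma ex_closed_length: "\<exists>L. closed_length L"
proof -
  have "((v 0, 0), (v (int k), int k)) \<in> step\<^sup>*" for k
  proof (induction k)
    case (Suc k)
    then show ?case
      using steps_segment[of "int k"] by (simp add: add.commute rtrancl_trans)
  qed simp
  then show ?thesis
    unfolding closed_length_def
    by (metis add_0 v_periodic rtrancl_power)
qed

text \<open>Minimality of the walk excludes chords between positions; only then is the resulting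
  adjacency used to exclude repeated vertices.\<close>

lemma ex_induced_cycle:
  obtains L X where "n \<le> L" "inj_on X {..<L}"
    "\<And>a b. \<lbrakk>a < L; b < L\<rbrakk> \<Longrightarrow> (X a, X b) \<in> E \<longleftrightarrow> b = Suc a mod L \<or> a = Suc b mod L"
proof -
  define L where "L = (LEAST L. closed_length L)"
  have L_le: "L \<le> L'" if "closed_length L'" for L'
    unfolding L_def using that by (rule Least_le)
  have L: "closed_length L"
    unfolding L_def using ex_closed_length by (rule LeastI_ex)
  have nL: "n \<le> L" using closed_length_ge L .
  with n_ge have L6: "6 \<le> L" by simp
  obtain x J0 f where f0: "f 0 = (x, J0)" and fL: "f L = (x, J0 + int n)"
    and f_step: "\<And>i. i < L \<Longrightarrow> (f i, f (Suc i)) \<in> step"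
    using L by (auto simp: closed_length_def relpow_fun_conv)
  define X J where "X = fst \<circ> f" and "J = snd \<circ> f"
  have f: "f i = (X i, J i)" for i by (simp add: X_def J_def)
  have XL: "X L = X 0" "J L = J 0 + int n" using f0 fL f by auto
  have X_edge: "(X i, X (Suc i)) \<in> E" and X_near: "near (J i) (X i)" and J_mono1: "J i \<le> J (Suc i)"
    if "i < L" for i
    using f_step[OF that] by (auto simp: f step_def)
  have sub: "(f a, f (a + k)) \<in> step ^^ k" if "a + k \<le> L" for a k
    using f_step that unfolding relpow_fun_conv
    by (intro exI[of _ "\<lambda>i. f (a + i)"]) auto
  have J_mono: "J a \<le> J b" if "a \<le> b" "b \<le> L" for a b
    using that
  proof (induction b rule: dec_induct)
    case (step b)
    then show ?case using J_mono1[of b] by linarith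
  qed simp
  have chord: "b = Suc a \<or> a = 0 \<and> Suc b = L"
    if ab: "a < b" "b < L" and E: "(X a, X b) \<in> E" for a b
  proof -
    obtain e where e: "- 2 \<le> e" "e \<le> 2" "int n dvd J b - J a - e"
      using near_adjacent X_near[of a] X_near[of b] E ab by (metis less_trans)
    have "0 \<le> J b - J a" "J b - J a \<le> int n"
      using J_mono[of a b] J_mono[of 0 a] J_mono[of b L] XL ab by auto
    moreover obtain q where q: "J b - J a - e = int n * q" using e by (auto elim: dvdE)
    ultimately have "int n * q > int n * (-1)" "int n * q < int n * 2" using e n_ge by linarith+
    \<comment> \<open>So the labels at \<open>a\<close> and \<open>b\<close> differ by
      \<open>e\<close> or by \<open>n + e\<close>. In the first case the chord is a step that
      bypasses the walk between \<open>a\<close> and \<open>b\<close>; in the second it closes that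
      part of the walk into one that already winds around once. Both walks would be too short unless
      the edge belongs to the cycle.\<close>
    then have "q = 0 \<or> q = 1" by (simp only: mult_less_cancel_left) auto
    then show ?thesis
    proof
      assume "q = 0"
      then have "(f a, f b) \<in> step"
        using e q E X_near[of a] X_near[of b] ab \<open>0 \<le> J b - J a\<close> by (auto simp: f step_def)
      then have "(f 0, f b) \<in> step ^^ Suc a" using sub[of 0 a] ab by auto
      then have "(f 0, f L) \<in> step ^^ (Suc a + (L - b))"
        using sub[of b "L - b"] ab unfolding relpow_add by (simp add: relcompI del: relpow.simps)
      then have "closed_length (Suc a + (L - b))"
        unfolding closed_length_def f0 fL by blast
      then show ?thesis using L_le[of "Suc a + (L - b)"] ab by linarith
    next
      assume "q = 1"
      then have "(f b, (X a, J a + int n)) \<in> step"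
        using e q E_sym[OF E] X_near[of a] X_near[of b] ab \<open>J b - J a \<le> int n\<close>
        by (auto simp: f step_def near_shift)
      then have "(f a, (X a, J a + int n)) \<in> step ^^ Suc (b - a)"
        using sub[of a "b - a"] ab by auto
      then have "closed_length (Suc (b - a))"
        unfolding closed_length_def f by blast
      then show ?thesis using L_le[of "Suc (b - a)"] ab by linarith
    qed
  qed
  have edge_mod: "(X a, X (Suc a mod L)) \<in> E" if "a < L" for a
    using X_edge[OF that] XL that by (cases "Suc a = L") auto
  have adj: "(X a, X b) \<in> E \<longleftrightarrow> b = Suc a mod L \<or> a = Suc b mod L" if ab: "a < L" "b < L" for a b
  proof
    assume E: "(X a, X b) \<in> E"
    consider "a < b" | "b < a" using E E_irrefl by (metis linorder_neqE_nat)
    then show "b = Suc a mod L \<or> a = Suc b mod L"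
      by cases (use chord[of a b] chord[of b a] E E_sym[OF E] ab in auto)
  qed (use edge_mod E_sym ab in blast)
  have neq: "X a \<noteq> X b" if ab: "a < b" "b < L" for a b
  proof
    assume eq: "X a = X b"
    have "(X b, X a) \<notin> E" using eq E_irrefl by simp
    then have b: "b \<noteq> Suc a" "b \<noteq> 0" using E_sym X_edge[of a] ab by auto
    \<comment> \<open>Equal vertices have equal neighbours, so the successor of each position is
      adjacent to the other position. Two steps forward then lead from \<open>a\<close> to
      \<open>b\<close> and from \<open>b\<close> to \<open>a\<close>, whence \<open>L\<close> would
      divide 4.\<close>
    have 1: "b = Suc (Suc a) mod L \<or> Suc a mod L = Suc b mod L"
      using adj[of "Suc a mod L" b] edge_mod[of a] E_sym eq ab by force
    have 2: "a = Suc (Suc b mod L) mod L \<or> Suc b mod L = Suc a mod L"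
      using adj[of "Suc b mod L" a] edge_mod[of b] E_sym eq ab by force
    show False
      using 1 2 ab b L6 by (auto simp: mod_Suc split: if_splits)
  qed
  have "inj_on X {..<L}"
    by (rule inj_onI) (metis lessThan_iff linorder_neqE_nat neq)
  then show thesis using that[of L X] nL adj by blast
qed

end

section \<open>Holes as cyclic sequences of vertices\<close>

text \<open>The equivalence covers both directions of each edge and excludes chords. No lower bound
  on \<open>n\<close> is built in, as only values above some \<open>k \<ge> 3\<close> matter for
  chordality.\<close>

definition cyclic_adjacency :: "'a rel \<Rightarrow> nat \<Rightarrow> (nat \<Rightarrow> 'a) \<Rightarrow> bool" where
  "cyclic_adjacency E n v \<longleftrightarrow> inj_on v {..<n} \<and>
     (\<forall>a<n. \<forall>b<n. (v a, v b) \<in> E \<longleftrightarrow> b = Suc a mod n \<or> a = Suc b mod n)"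

section \<open>Translation between arc lists and indexed vertices\<close>

lemma awalk_with_proj_eq:
  "pre_digraph.awalk (with_proj H) u p w \<longleftrightarrow> u \<in> pverts H \<and> set p \<subseteq> parcs H \<and> pcas u p w"
  by (simp add: pre_digraph.awalk_def cas_with_proj_eq)

lemma pcas_nth:
  "pcas u p w \<longleftrightarrow> (if p = [] then u = w else fst (p ! 0) = u \<and> snd (p ! (length p - 1)) = w \<and>
     (\<forall>i. Suc i < length p \<longrightarrow> snd (p ! i) = fst (p ! Suc i)))"
proof (induction p arbitrary: u)
  case (Cons e p)
  show ?case
  proof (cases p)
    case (Cons e' p')
    have "(\<forall>i. Suc i < length (e # p) \<longrightarrow> snd ((e # p) ! i) = fst ((e # p) ! Suc i)) \<longleftrightarrow>
      snd e = fst (p ! 0) \<and> (\<forall>i. Suc i < length p \<longrightarrow> snd (p ! i) = fst (p ! Suc i))"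
      using Cons by (auto simp: nth_Cons split: nat.splits)
    then show ?thesis using Cons.IH[of "snd e"] Cons by auto
  qed simp
qed simp

lemma pawalk_verts_conv: "pcas u p w \<Longrightarrow> pawalk_verts u p = u # map snd p"
  by (induction p arbitrary: u) auto

lemma cycle_with_proj_iff:
  "pre_digraph.cycle (with_proj H) p \<longleftrightarrow>
     (\<exists>u. u \<in> pverts H \<and> set p \<subseteq> parcs H \<and> pcas u p u \<and> distinct (map snd p) \<and> p \<noteq> [])"
  by (auto simp: pre_digraph.cycle_def awalk_with_proj_eq awalk_verts_with_proj_eq pawalk_verts_conv)

lemma hole_imp_cyclic_adjacency:
  assumes "hole H S"
  obtains n v where "S = v ` {..<n}" "cyclic_adjacency (parcs H) n v"
proof -
  obtain p u where p: "set p \<subseteq> parcs H" "pcas u p u" "distinct (map snd p)" "3 \<le> length p"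
    and S: "fst ` set p = S"
    and arcs: "{e \<in> parcs H. fst e \<in> S \<and> snd e \<in> S} = set p \<union> (set p)\<inverse>"
    using assms by (auto simp: hole_def cycle_with_proj_iff)
  define n where "n = length p"
  define v where "v i = fst (p ! i)" for i
  have n3: "3 \<le> n" using p n_def by simp
  have snd_p: "snd (p ! i) = v (Suc i mod n)" if "i < n" for i
    using p(2,4) that unfolding pcas_nth v_def n_def
    by (cases "i = length p - 1") (auto split: if_splits)
  have p_nth: "p ! i = (v i, v (Suc i mod n))" if "i < n" for i
    using snd_p[OF that] by (simp add: v_def prod_eq_iff)
  have "set p = (!) p ` {..<n}" by (auto simp: set_conv_nth n_def)
  also have "\<dots> = (\<lambda>i. (v i, v (Suc i mod n))) ` {..<n}" using p_nth by simp
  finally have set_p: "set p = (\<lambda>i. (v i, v (Suc i mod n))) ` {..<n}" .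
  have S_v: "S = v ` {..<n}"
    unfolding S[symmetric] set_p by force
  \<comment> \<open>A cycle is required to have distinct heads of arcs. The cyclic successor
    permutes the indices, so the tails, which define \<open>v\<close>, are distinct as well.\<close>
  have "distinct (map v (map (\<lambda>i. Suc i mod n) [0..<n]))"
  proof -
    have "map snd p = map v (map (\<lambda>i. Suc i mod n) [0..<n])"
      by (rule nth_equalityI) (use snd_p in \<open>auto simp: n_def\<close>)
    then show ?thesis using p(3) by metis
  qed
  then have "inj_on v ((\<lambda>i. Suc i mod n) ` {..<n})"
    by (intro inj_on_imageI) (simp add: distinct_map atLeast0LessThan)
  moreover have "(\<lambda>i. Suc i mod n) ` {..<n} = {..<n}"
  proof (intro equalityI subsetI)
    fix j assume j: "j \<in> {..<n}"
    show "j \<in> (\<lambda>i. Suc i mod n) ` {..<n}"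
    proof (cases j)
      case 0
      then show ?thesis using n3 by (intro image_eqI[of _ _ "n - 1"]) auto
    next
      case (Suc i)
      then show ?thesis using j by (intro image_eqI[of _ _ i]) auto
    qed
  qed (use n3 in auto)
  ultimately have inj: "inj_on v {..<n}" by simp
  have "(v a, v b) \<in> parcs H \<longleftrightarrow> b = Suc a mod n \<or> a = Suc b mod n" if ab: "a < n" "b < n" for a b
  proof -
    have "(v a, v b) \<in> parcs H \<longleftrightarrow> (v a, v b) \<in> set p \<union> (set p)\<inverse>"
      using ab unfolding arcs[symmetric] S_v by simp
    also have "\<dots> \<longleftrightarrow> b = Suc a mod n \<or> a = Suc b mod n"
    proof -
      have eq: "v c = v c' \<longleftrightarrow> c = c'" if "c < n" "c' < n" for c c'
        using inj_on_eq_iff[OF inj] that by simp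
      have succ: "(v c, v c') \<in> set p \<longleftrightarrow> c' = Suc c mod n" if "c < n" "c' < n" for c c'
      proof -
        have "(v c, v c') \<in> set p \<longleftrightarrow> (\<exists>i<n. v c = v i \<and> v c' = v (Suc i mod n))"
          unfolding set_p by auto
        also have "\<dots> \<longleftrightarrow> (\<exists>i<n. c = i \<and> c' = Suc i mod n)"
          using that n3 by (intro ex_cong1 conj_cong refl) (simp_all add: eq)
        finally show ?thesis using that by auto
      qed
      show ?thesis using succ[of a b] succ[of b a] ab by simp
    qed
    finally show ?thesis .
  qed
  then show thesis
    using that[OF S_v] inj by (simp add: cyclic_adjacency_def)
qed

lemma cyclic_adjacency_imp_hole:
  assumes "pair_wf_digraph H" and "3 \<le> n" and "cyclic_adjacency (parcs H) n v"
  shows "hole H (v ` {..<n})"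
proof -
  interpret pair_wf_digraph H by fact
  have inj: "inj_on v {..<n}"
    and adj: "\<And>a b. \<lbrakk>a < n; b < n\<rbrakk> \<Longrightarrow> (v a, v b) \<in> parcs H \<longleftrightarrow> b = Suc a mod n \<or> a = Suc b mod n"
    using assms by (auto simp: cyclic_adjacency_def)
  define p where "p = map (\<lambda>i. (v i, v (Suc i mod n))) [0..<n]"
  have len: "length p = n" by (simp add: p_def)
  have nth: "p ! i = (v i, v (Suc i mod n))" if "i < n" for i
    using that by (simp add: p_def)
  have sub: "set p \<subseteq> parcs H"
    using adj assms(2) by (auto simp: p_def)
  have "pcas (v 0) p (v 0)"
    using assms(2) len by (auto simp: pcas_nth nth)
  moreover have "v 0 \<in> pverts H"
    using adj[of 0 1] assms(2) in_arcsD1[of "v 0" "v 1"] by simp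
  moreover have "distinct (map snd p)"
  proof -
    have "inj_on (\<lambda>i. Suc i mod n) {..<n}"
      by (auto simp: inj_on_def mod_Suc split: if_splits)
    then have "inj_on (v \<circ> (\<lambda>i. Suc i mod n)) {..<n}"
      using inj assms(2) by (intro comp_inj_on) (auto intro: inj_on_subset)
    then show ?thesis
      by (simp add: p_def distinct_map atLeast0LessThan comp_def)
  qed
  ultimately have cyc: "pre_digraph.cycle (with_proj H) p"
    using sub assms(2) len by (auto simp: cycle_with_proj_iff)
  have S: "fst ` set p = v ` {..<n}"
    by (force simp: p_def)
  have "{e \<in> parcs H. fst e \<in> v ` {..<n} \<and> snd e \<in> v ` {..<n}} = set p \<union> (set p)\<inverse>"
  proof (intro equalityI subsetI)
    fix e assume "e \<in> {e \<in> parcs H. fst e \<in> v ` {..<n} \<and> snd e \<in> v ` {..<n}}"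
    then obtain a b where ab: "a < n" "b < n" "fst e = v a" "snd e = v b" and "e \<in> parcs H"
      by auto
    moreover from ab have "e = (v a, v b)" by (simp add: prod_eq_iff)
    ultimately show "e \<in> set p \<union> (set p)\<inverse>" using adj[of a b] by (auto simp: p_def)
  next
    fix e assume "e \<in> set p \<union> (set p)\<inverse>"
    then obtain a where "a < n" "e = (v a, v (Suc a mod n)) \<or> e = (v (Suc a mod n), v a)"
      by (auto simp: p_def)
    then show "e \<in> {e \<in> parcs H. fst e \<in> v ` {..<n} \<and> snd e \<in> v ` {..<n}}"
      using adj[of a "Suc a mod n"] adj[of "Suc a mod n" a] by auto
  qed
  then show ?thesis
    using cyc S len assms(2) by (auto simp: hole_def)
qed

text \<open>\<open>3 \<le> k\<close> supplies the length bound in \<open>hole\<close>, and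
  injectivity identifies \<open>n\<close> with the number of vertices.\<close>

lemma k_chordal_iff:
  assumes "pair_wf_digraph H" and "3 \<le> k"
  shows "k_chordal k H \<longleftrightarrow> \<not> (\<exists>n v. k < n \<and> cyclic_adjacency (parcs H) n v)"
proof -
  have card: "card (v ` {..<n}) = n" if "cyclic_adjacency (parcs H) n v" for n v
    using that by (simp add: cyclic_adjacency_def card_image)
  have "(\<exists>S. hole H S \<and> k < card S) \<longleftrightarrow> (\<exists>n v. k < n \<and> cyclic_adjacency (parcs H) n v)"
  proof
    assume "\<exists>S. hole H S \<and> k < card S"
    then obtain S where "hole H S" "k < card S" by blast
    moreover from this(1) obtain n v where "S = v ` {..<n}" "cyclic_adjacency (parcs H) n v"
      by (rule hole_imp_cyclic_adjacency)
    ultimately show "\<exists>n v. k < n \<and> cyclic_adjacency (parcs H) n v" using card by metis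
  next
    assume "\<exists>n v. k < n \<and> cyclic_adjacency (parcs H) n v"
    then obtain n v where "k < n" "cyclic_adjacency (parcs H) n v" by blast
    then show "\<exists>S. hole H S \<and> k < card S"
      using cyclic_adjacency_imp_hole[OF assms(1), of n v] card[of n v] assms(2)
      by (intro exI[of _ "v ` {..<n}"]) simp
  qed
  then show ?thesis by (simp add: k_chordal_def)
qed

section \<open>Walk lengths and distances\<close>

text \<open>A natural number, so that parity makes sense; the value is unspecified if
  \<open>y\<close> cannot be reached from \<open>x\<close>.\<close>

definition walk_dist :: "'a rel \<Rightarrow> 'a \<Rightarrow> 'a \<Rightarrow> nat" where
  "walk_dist E x y = (LEAST k. (x, y) \<in> E ^^ k)"

lemma relpow_walk_dist: "(x, y) \<in> E\<^sup>* \<Longrightarrow> (x, y) \<in> E ^^ walk_dist E x y"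
  unfolding walk_dist_def rtrancl_power by (rule LeastI_ex)

lemma walk_dist_le: "(x, y) \<in> E ^^ k \<Longrightarrow> walk_dist E x y \<le> k"
  unfolding walk_dist_def by (rule Least_le)

lemma walk_dist_triangle:
  assumes "(x, y) \<in> E\<^sup>*" "(y, z) \<in> E\<^sup>*"
  shows "walk_dist E x z \<le> walk_dist E x y + walk_dist E y z"
  using assms[THEN relpow_walk_dist] by (auto intro!: walk_dist_le simp: relpow_add)

lemma sym_relpow: "sym E \<Longrightarrow> sym (E ^^ k)"
proof (induction k)
  case (Suc k)
  show ?case
    by (rule symI) (use Suc in \<open>auto simp del: relpow.simps dest!: relpow_Suc_D2
      intro: relpow_Suc_I dest: symD\<close>)
qed (auto simp: sym_def)

lemma walk_dist_sym: "sym E \<Longrightarrow> walk_dist E x y = walk_dist E y x"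
  unfolding walk_dist_def by (metis sym_relpow symD)

text \<open>Every arc changes sides.\<close>

lemma relpow_parity:
  assumes "A \<inter> B = {}" "E \<subseteq> A \<times> B \<union> B \<times> A" "(x, y) \<in> E ^^ k"
  shows "(x \<in> A \<longleftrightarrow> y \<in> A) \<longleftrightarrow> even k"
  using assms(3)
proof (induction k arbitrary: y)
  case (Suc k)
  then obtain z where "(x, z) \<in> E ^^ k" "(z, y) \<in> E" by auto
  then show ?case using Suc.IH[of z] assms(1,2) by auto
qed simp

context pair_wf_digraph
begin

lemma relpow_iff_awalk:
  assumes "u \<in> pverts G"
  shows "(u, w) \<in> parcs G ^^ k \<longleftrightarrow> (\<exists>p. awalk u p w \<and> length p = k)"
  using assms
proof (induction k arbitrary: u)
  case 0
  then show ?case by (auto simp: awalk_Nil_iff)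
next
  case (Suc k)
  have "(u, w) \<in> parcs G ^^ Suc k \<longleftrightarrow> (\<exists>x. (u, x) \<in> parcs G \<and> (x, w) \<in> parcs G ^^ k)"
    by (blast dest: relpow_Suc_D2 intro: relpow_Suc_I2)
  also have "\<dots> \<longleftrightarrow> (\<exists>x p. (u, x) \<in> parcs G \<and> awalk x p w \<and> length p = k)"
    using Suc.IH in_arcsD2 by blast
  also have "\<dots> \<longleftrightarrow> (\<exists>p. awalk u p w \<and> length p = Suc k)"
  proof
    assume "\<exists>x p. (u, x) \<in> parcs G \<and> awalk x p w \<and> length p = k"
    then obtain x p where "(u, x) \<in> parcs G" "awalk x p w" "length p = k" by blast
    then show "\<exists>p. awalk u p w \<and> length p = Suc k"
      by (intro exI[of _ "(u, x) # p"]) (simp add: awalk_Cons_iff)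
  next
    assume "\<exists>p. awalk u p w \<and> length p = Suc k"
    then obtain e p where "awalk u (e # p) w" "length p = k" by (auto simp: length_Suc_conv)
    then show "\<exists>x p. (u, x) \<in> parcs G \<and> awalk x p w \<and> length p = k"
      by (intro exI[of _ "snd e"] exI[of _ p]) (simp add: awalk_Cons_iff)
  qed
  finally show ?case .
qed

text \<open>With unit costs \<open>\<mu>\<close> is the infimum of the walk lengths. It is attained
  by a shortest walk, and without any walk it is the infimum of the empty set,
  \<open>\<infinity>\<close>.\<close>

lemma gdist_eq_iff_walk_dist:
  assumes u: "u \<in> pverts G"
  shows "gdist G u w = ereal (real k) \<longleftrightarrow>
    (u, w) \<in> (parcs G)\<^sup>* \<and> k = walk_dist (parcs G) u w"
proof -
  have cost: "awalk_cost (\<lambda>_. 1) p = real (length p)" for p :: "('a \<times> 'a) list"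
    by (induction p) (auto simp: awalk_cost_def)
  let ?d = "walk_dist (parcs G) u w"
  have reach: "gdist G u w = ereal (real ?d)" if uw: "(u, w) \<in> (parcs G)\<^sup>*"
  proof -
    have "(u, w) \<in> parcs G ^^ ?d"
      using uw by (rule relpow_walk_dist)
    then obtain p where p: "awalk u p w" "length p = ?d"
      using relpow_iff_awalk[OF u] by blast
    have "?d \<le> length q" if "awalk u q w" for q
      using that relpow_iff_awalk[OF u] by (intro walk_dist_le) blast
    then show ?thesis
      unfolding gdist_def \<mu>_def
      using p by (intro antisym INF_greatest INF_lower2[of p]) (auto simp: cost)
  qed
  moreover have "gdist G u w = \<infinity>" if "(u, w) \<notin> (parcs G)\<^sup>*"
  proof -
    have "{p. awalk u p w} = {}"
      using that relpow_iff_awalk[OF u] unfolding rtrancl_power by blast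
    then show ?thesis unfolding gdist_def \<mu>_def by (simp add: top_ereal_def)
  qed
  ultimately show ?thesis by force
qed

end

section \<open>Holes in bipartite powers\<close>

text \<open>Turns the cyclic successor of reduced indices into the divisibility conditions on
  integer labels.\<close>

lemma nat_mod_eq_Suc_mod:
  assumes "0 < n"
  shows "nat (j mod int n) = Suc (nat (i mod int n)) mod n \<longleftrightarrow> int n dvd j - i - 1"
proof -
  have "nat (j mod int n) = Suc (nat (i mod int n)) mod n \<longleftrightarrow>
    j mod int n = int (Suc (nat (i mod int n)) mod n)"
    using assms by (simp add: nat_eq_iff)
  also have "int (Suc (nat (i mod int n)) mod n) = (i + 1) mod int n"
    using assms by (simp add: zmod_int mod_add_right_eq add.commute[of i])
  finally show ?thesis by (simp add: mod_eq_dvd_iff diff_diff_eq)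
qed

lemma parcs_bipartite_power:
  assumes "pair_wf_digraph G"
  shows "(x, y) \<in> parcs (bipartite_power G m) \<longleftrightarrow> x \<in> pverts G \<and> y \<in> pverts G \<and>
    (x, y) \<in> (parcs G)\<^sup>* \<and> odd (walk_dist (parcs G) x y) \<and> walk_dist (parcs G) x y \<le> m"
  using pair_wf_digraph.gdist_eq_iff_walk_dist[OF assms] by (auto simp: bipartite_power_def)

lemma pair_wf_bipartite_power: "pair_wf_digraph (bipartite_power G m)"
  by unfold_locales (auto simp: bipartite_power_def)

text \<open>Arcs of the power join vertices at odd distance, so the two sides alternate along the
  hole.\<close>

lemma spread_cycle_of_hole_in_power:
  assumes "pair_graph G" "bipartite G" "odd m" "4 < n"
    and hole: "cyclic_adjacency (parcs (bipartite_power G m)) n w"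
  shows "spread_cycle (parcs G) {x. (w 0, x) \<in> (parcs G)\<^sup>*} (walk_dist (parcs G)) m n
    (\<lambda>i. w (nat (i mod int n)))"
proof -
  interpret pair_graph G by fact
  let ?E = "parcs G" and ?H = "parcs (bipartite_power G m)" and ?v = "\<lambda>i. w (nat (i mod int n))"
  obtain A B where AB: "A \<inter> B = {}" "?E \<subseteq> A \<times> B \<union> B \<times> A"
    using assms(2) by (auto simp: bipartite_def)
  have symE: "sym ?E" using pair_sym_arcs by (simp add: symmetric_def)
  note H = parcs_bipartite_power[OF pair_wf_digraph, of _ _ m]
  have arc: "(w a, w b) \<in> ?H \<longleftrightarrow> b = Suc a mod n \<or> a = Suc b mod n" if "a < n" "b < n" for a b
    using hole that by (auto simp: cyclic_adjacency_def)
  have conn: "(w 0, w a) \<in> ?E\<^sup>*" if "a < n" for a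
    using that
  proof (induction a)
    case (Suc a)
    then have "(w a, w (Suc a)) \<in> ?H" by (simp add: arc)
    then show ?case using Suc H by (auto intro: rtrancl_trans)
  qed simp
  have parity: "(x \<in> A \<longleftrightarrow> y \<in> A) \<longleftrightarrow> even (walk_dist ?E x y)" if "(x, y) \<in> ?E\<^sup>*" for x y
    using relpow_parity[OF AB relpow_walk_dist[OF that]] .
  have alternate: "(x \<in> A) \<noteq> (y \<in> A)" if "(x, y) \<in> ?H" for x y
    using parity that by (auto simp: H)
  have color: "(w a \<in> A \<longleftrightarrow> w 0 \<in> A) \<longleftrightarrow> even a" if "a < n" for a
    using that
  proof (induction a)
    case (Suc a)
    then have "(w a, w (Suc a)) \<in> ?H" by (simp add: arc)
    then show ?case using Suc alternate by auto
  qed simp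
  \<comment> \<open>The arc that closes the hole also changes sides, which forces \<open>n\<close>
    to be even.\<close>
  have "(w (n - 1), w 0) \<in> ?H" using arc[of "n - 1" 0] assms(4) by simp
  then have "(w (n - 1) \<in> A) \<noteq> (w 0 \<in> A)" by (rule alternate)
  then have "odd (n - 1)" using color[of "n - 1"] assms(4) by simp
  then have n_even: "even n" using assms(4) by simp
  have idx: "nat (i mod int n) < n" for i
    using assms(4) by (simp add: nat_less_iff)
  have v_color: "(?v i \<in> A \<longleftrightarrow> w 0 \<in> A) \<longleftrightarrow> even i" for i
    using color[OF idx[of i]] n_even assms(4) by (simp add: even_nat_iff dvd_mod_iff)
  have v_conn: "(w 0, ?v i) \<in> ?E\<^sup>*" for i using conn idx by blast
  have conn_sym: "(x, y) \<in> ?E\<^sup>*" if "(w 0, x) \<in> ?E\<^sup>*" "(w 0, y) \<in> ?E\<^sup>*" for x y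
    using that sym_rtrancl[OF symE] by (meson rtrancl_trans symD)
  have v_arc: "(?v i, ?v j) \<in> ?H \<longleftrightarrow> int n dvd j - i - 1 \<or> int n dvd j - i + 1" for i j
  proof -
    have "int n dvd i - j - 1 \<longleftrightarrow> int n dvd j - i + 1"
      using dvd_minus_iff[of "int n" "j - i + 1"] by (simp add: algebra_simps)
    then show ?thesis using arc[OF idx idx, of i j] nat_mod_eq_Suc_mod[of n] assms(4) by simp
  qed
  have v_verts: "?v i \<in> pverts G" for i
    using v_arc[of i "i + 1"] by (simp add: H)
  show ?thesis
  proof unfold_locales
    fix x y assume "(x, y) \<in> ?E" then show "(y, x) \<in> ?E" using symE by (meson symD)
  next
    fix x show "(x, x) \<notin> ?E" using no_loops' by blast
  next
    fix x show "walk_dist ?E x x = 0" using walk_dist_le[of x x 0 ?E] by simp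
  next
    fix x y show "walk_dist ?E x y = walk_dist ?E y x" using walk_dist_sym[OF symE] .
  next
    fix x y z assume "x \<in> {x. (w 0, x) \<in> ?E\<^sup>*}" "y \<in> {x. (w 0, x) \<in> ?E\<^sup>*}"
      "z \<in> {x. (w 0, x) \<in> ?E\<^sup>*}"
    then show "walk_dist ?E x z \<le> walk_dist ?E x y + walk_dist ?E y z"
      using conn_sym by (intro walk_dist_triangle) auto
  next
    fix x y assume "x \<in> {x. (w 0, x) \<in> ?E\<^sup>*}" "(x, y) \<in> ?E"
    then show "y \<in> {x. (w 0, x) \<in> ?E\<^sup>*}" by (simp add: rtrancl_into_rtrancl)
  next
    fix x y assume "(x, y) \<in> ?E"
    then show "walk_dist ?E x y \<le> 1" using walk_dist_le[of x y 1 ?E] by simp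
  next
    fix x y assume "x \<in> {x. (w 0, x) \<in> ?E\<^sup>*}" "y \<in> {x. (w 0, x) \<in> ?E\<^sup>*}"
    then show "(x, y) \<in> ?E ^^ walk_dist ?E x y"
      using conn_sym by (intro relpow_walk_dist) auto
  next
    fix i show "?v i \<in> {x. (w 0, x) \<in> ?E\<^sup>*}" using v_conn by simp
  next
    fix i show "?v (i + int n) = ?v i" by simp
  next
    fix i :: int
    show "?v i \<noteq> ?v (i + 1)" using v_color[of i] v_color[of "i + 1"] by auto
    show "walk_dist ?E (?v i) (?v (i + 1)) \<le> m" using v_arc[of i "i + 1"] by (simp add: H)
  next
    fix i j :: int
    assume odd: "odd (j - i)" and far: "\<not> int n dvd j - i - 1" "\<not> int n dvd j - i + 1"
    have c: "(?v i, ?v j) \<in> ?E\<^sup>*" using conn_sym v_conn by blast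
    have "odd (walk_dist ?E (?v i) (?v j))"
      using parity[OF c] v_color[of i] v_color[of j] odd by auto
    \<comment> \<open>A missing arc could also be due to an even distance or to different
      components; parity and \<open>c\<close> rule these out. As \<open>m\<close> and the distance
      are both odd, exceeding \<open>m\<close> means being at least \<open>m + 2\<close>.\<close>
    moreover from this have "m < walk_dist ?E (?v i) (?v j)"
      using v_arc[of i j] far c v_verts by (auto simp: H)
    ultimately show "m + 2 \<le> walk_dist ?E (?v i) (?v j)"
      using assms(3) by presburger
  next
    show "even n" by fact
    show "6 \<le> n" using n_even assms(4) by presburger
  qed
qed

theorem theorem1:
  fixes G :: "'a pair_pre_digraph" and m k :: nat
  assumes "0 < m" and "odd m" and "4 \<le> k"
    and "pair_graph G" and "bipartite G"
    and "k_chordal k G"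
  shows "k_chordal k (bipartite_power G m)"
proof (rule ccontr)
  interpret pair_graph G by fact
  assume "\<not> k_chordal k (bipartite_power G m)"
  then obtain n w where n: "k < n"
    and hole: "cyclic_adjacency (parcs (bipartite_power G m)) n w"
    using k_chordal_iff[OF pair_wf_bipartite_power, of k G m] assms(3) by auto
  interpret spread_cycle "parcs G" "{x. (w 0, x) \<in> (parcs G)\<^sup>*}" "walk_dist (parcs G)" m n
    "\<lambda>i. w (nat (i mod int n))"
    using spread_cycle_of_hole_in_power[OF assms(4,5,2) _ hole] assms(3) n by simp
  obtain L X where "n \<le> L" "cyclic_adjacency (parcs G) L X"
    using ex_induced_cycle unfolding cyclic_adjacency_def by metis
  then show False
    using k_chordal_iff[OF pair_wf_digraph, of k] assms(3,6) n by auto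
qed

end
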